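(* Let $F$ be an arbitrary field, let $R$ be an associative $F$-algebra with non-trivial center, and let $V\subseteq R$ be a vector subspace which generates $R$ as an algebra. Let $c(x_1,\ldots,x_n)\in F\langle X\rangle$ be a non-trivial multilinear central polynomial of the algebra $R$. Then there exists a polynomial $c'(Y)\in F\langle Y\rangle$ which is a non-trivial central polynomial for the pair $(R,V)$.
   Context: $F\langle X\rangle=F\langle x_1,x_2,\ldots\rangle$ and $F\langle Y\rangle$ denote free associative algebras over $F$, where $Y=\{y_{ij}\}$ is another set of free variables. A polynomial $f(x_1,\ldots,x_n)$ is an identity for the pair $(R,V)$ if $f(v_1,\ldots,v_n)=0$ for all $v_1,\ldots,v_n\in V$. A polynomial $c(x_1,\ldots,x_n)$ is a (non-trivial, or essential) central polynomial for the pair $(R,V)$ if $c(v_1,\ldots,v_n)$ belongs to the center of $R$ for all $v_1,\ldots,v_n\in V$ and $c$ is not an identity for $(R,V)$. A (non-trivial) central polynomial of the algebra $R$ is a central polynomial for the pair $(R,R)$. Multilinear means linear in each of the variables $x_1,\ldots,x_n$ (each monomial contains each $x_i$ exactly once). *)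

theory Defs
  imports Complex_Main "HOL-Library.Poly_Mapping"
begin

text \<open>
  Associative algebras over a field. They need not have a unit: the type class \<open>ring\<close> asks
  for none.
\<close>

locale assoc_algebra = vector_space scale
  for scale :: "'f::field \<Rightarrow> 'r::ring \<Rightarrow> 'r" +
  assumes scale_mult_left: "scale a x * y = scale a (x * y)"
    and scale_mult_right: "x * scale a y = scale a (x * y)"

definition subalgebra :: "('f::field \<Rightarrow> 'r::ring \<Rightarrow> 'r) \<Rightarrow> 'r set \<Rightarrow> bool" where
  "subalgebra scale S \<longleftrightarrow> module.subspace scale S \<and> (\<forall>x\<in>S. \<forall>y\<in>S. x * y \<in> S)"

definition generates_algebra :: "('f::field \<Rightarrow> 'r::ring \<Rightarrow> 'r) \<Rightarrow> 'r set \<Rightarrow> bool" where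
  "generates_algebra scale V \<longleftrightarrow> subalgebra scale hull V = UNIV"

definition center :: "'r::ring set" where
  "center = {z. \<forall>x. z * x = x * z}"

text \<open>
  The free associative algebra \<open>F\<langle>X\<rangle>\<close> has the non-empty words in the variables \<open>X\<close>
  as a basis over \<open>F\<close>. As algebras need not have a unit, there is no empty word, so polynomials
  have no constant term. The product of \<open>F\<langle>X\<rangle>\<close> is not needed and therefore not defined.
\<close>

datatype 'x word = Var 'x | Var_times 'x "'x word"

type_synonym ('x, 'f) free_algebra = "'x word \<Rightarrow>\<^sub>0 'f"

primrec letters :: "'x word \<Rightarrow> 'x list" where
  "letters (Var x) = [x]"
| "letters (Var_times x w) = x # letters w"

primrec word_eval :: "('x \<Rightarrow> 'r::ring) \<Rightarrow> 'x word \<Rightarrow> 'r" where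
  "word_eval v (Var x) = v x"
| "word_eval v (Var_times x w) = v x * word_eval v w"

definition poly_eval ::
    "('f::field \<Rightarrow> 'r::ring \<Rightarrow> 'r) \<Rightarrow> ('x \<Rightarrow> 'r) \<Rightarrow> ('x, 'f) free_algebra \<Rightarrow> 'r" where
  "poly_eval scale v p =
     (\<Sum>w\<in>Poly_Mapping.keys p. scale (Poly_Mapping.lookup p w) (word_eval v w))"

text \<open>
  A polynomial involves only finitely many variables, so for non-empty \<open>V\<close> evaluating it on tuples from \<open>V\<close> is the
  same as evaluating it under assignments of elements of \<open>V\<close> to all variables.
\<close>

definition pair_identity ::
    "('f::field \<Rightarrow> 'r::ring \<Rightarrow> 'r) \<Rightarrow> 'r set \<Rightarrow> ('x, 'f) free_algebra \<Rightarrow> bool" where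
  "pair_identity scale V p \<longleftrightarrow> (\<forall>v. (\<forall>i. v i \<in> V) \<longrightarrow> poly_eval scale v p = 0)"

definition central_polynomial_pair ::
    "('f::field \<Rightarrow> 'r::ring \<Rightarrow> 'r) \<Rightarrow> 'r set \<Rightarrow> ('x, 'f) free_algebra \<Rightarrow> bool" where
  "central_polynomial_pair scale V p \<longleftrightarrow>
     (\<forall>v. (\<forall>i. v i \<in> V) \<longrightarrow> poly_eval scale v p \<in> center) \<and> \<not> pair_identity scale V p"

definition central_polynomial ::
    "('f::field \<Rightarrow> 'r::ring \<Rightarrow> 'r) \<Rightarrow> ('x, 'f) free_algebra \<Rightarrow> bool" where
  "central_polynomial scale p \<longleftrightarrow> central_polynomial_pair scale UNIV p"

definition multilinear :: "nat \<Rightarrow> (nat, 'f::field) free_algebra \<Rightarrow> bool" where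
  "multilinear n p \<longleftrightarrow>
     (\<forall>w\<in>Poly_Mapping.keys p. distinct (letters w) \<and> set (letters w) = {1..n})"

end

theory Submission
  imports Defs
begin

text \<open>
  Since \<open>V\<close> generates \<open>R\<close>, the products of elements of \<open>V\<close> span \<open>R\<close>. By multilinearity, \<open>c\<close> then
  has a nonzero value at a tuple \<open>(m\<^sub>1, \<dots>, m\<^sub>n)\<close> of such products. Substituting for each \<open>x\<^sub>i\<close> a word
  in fresh variables \<open>y\<^sub>i\<^sub>j\<close> of the shape of \<open>m\<^sub>i\<close> turns \<open>c\<close> into the required \<open>c'\<close>: its values on \<open>V\<close>
  are values of \<open>c\<close> on \<open>R\<close>, hence central, and one of them is \<open>c(m\<^sub>1, \<dots>, m\<^sub>n)\<close>.
\<close>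

primrec append_word :: "'x word \<Rightarrow> 'x word \<Rightarrow> 'x word" where
  "append_word (Var x) w' = Var_times x w'"
| "append_word (Var_times x w) w' = Var_times x (append_word w w')"

primrec subst_word :: "('x \<Rightarrow> 'y word) \<Rightarrow> 'x word \<Rightarrow> 'y word" where
  "subst_word s (Var x) = s x"
| "subst_word s (Var_times x w) = append_word (s x) (subst_word s w)"

lemma word_eval_append_word [simp]:
  "word_eval v (append_word w w') = word_eval v w * word_eval v w'"
  by (induction w) (simp_all add: mult.assoc)

lemma word_eval_subst_word:
  "word_eval v (subst_word s w) = word_eval (\<lambda>x. word_eval v (s x)) w"
  by (induction w) simp_all

lemma word_eval_map_word: "word_eval v (map_word f w) = word_eval (\<lambda>x. v (f x)) w"
  by (induction w) simp_all

lemma word_eval_cong: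
  "(\<And>x. x \<in> set (letters w) \<Longrightarrow> u x = v x) \<Longrightarrow> word_eval u w = word_eval v w"
  by (induction w) simp_all

lemma word_eval_upd_other: "i \<notin> set (letters w) \<Longrightarrow> word_eval (v(i := x)) w = word_eval v w"
  by (rule word_eval_cong) auto

text \<open>In the induction, a letter that occurs exactly once is either the head, so that the tail
  keeps its value, or lies only in the tail; distributivity does the rest.\<close>

lemma word_eval_upd_add:
  assumes "distinct (letters w)" and "i \<in> set (letters w)"
  shows "word_eval (v(i := x + y)) w = word_eval (v(i := x)) w + word_eval (v(i := y)) w"
  using assms by (induction w) (auto simp: word_eval_upd_other algebra_simps)

lemma poly_eval_cong:
  assumes "\<And>w x. w \<in> Poly_Mapping.keys p \<Longrightarrow> x \<in> set (letters w) \<Longrightarrow> u x = v x"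
  shows "poly_eval scale u p = poly_eval scale v p"
  unfolding poly_eval_def using assms
  by (auto intro!: sum.cong arg_cong[where f = "scale _"] word_eval_cong)

text \<open>This is the multiplicative semigroup generated by \<open>V\<close>. Each element is
  presented by a word in variables indexed by \<open>nat\<close>, since the shape of that word is
  what gets substituted later.\<close>

definition products :: "'r::ring set \<Rightarrow> 'r set" where
  "products V = {word_eval u w | (u :: nat \<Rightarrow> 'r) w. range u \<subseteq> V}"

lemma subset_products: "V \<subseteq> products V"
proof
  fix x assume "x \<in> V"
  then have "x = word_eval (\<lambda>_. x) (Var (0 :: nat)) \<and> range (\<lambda>_ :: nat. x) \<subseteq> V" by auto
  then show "x \<in> products V" unfolding products_def by blast
qed

lemma products_mult:
  assumes "x \<in> products V" and "y \<in> products V"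
  shows "x * y \<in> products V"
proof -
  obtain u1 u2 :: "nat \<Rightarrow> 'a" and w1 w2
    where x: "x = word_eval u1 w1" "range u1 \<subseteq> V" and y: "y = word_eval u2 w2" "range u2 \<subseteq> V"
    using assms unfolding products_def by blast
  \<comment> \<open>Even indices carry the letters of the first factor and odd ones those of the
    second, so that one assignment serves both words.\<close>
  define u where "u k = (if even k then u1 (k div 2) else u2 (k div 2))" for k
  have "x * y = word_eval u (append_word (map_word (\<lambda>k. 2 * k) w1) (map_word (\<lambda>k. 2 * k + 1) w2))"
    by (simp add: x y word_eval_map_word u_def)
  moreover have "range u \<subseteq> V" using x y by (auto simp: u_def)
  ultimately show ?thesis unfolding products_def by blast
qed

context assoc_algebra
begin

lemma word_eval_upd_scale:
  assumes "distinct (letters w)" and "i \<in> set (letters w)"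
  shows "word_eval (v(i := scale a x)) w = scale a (word_eval (v(i := x)) w)"
  using assms by (induction w) (auto simp: word_eval_upd_other scale_mult_left scale_mult_right)

text \<open>The product is bilinear, so one span induction for each factor reduces the claim to
  elements of \<open>S\<close>.\<close>

lemma span_mult_closed:
  assumes closed: "\<And>x y. x \<in> S \<Longrightarrow> y \<in> S \<Longrightarrow> x * y \<in> S"
    and x: "x \<in> span S" and y: "y \<in> span S"
  shows "x * y \<in> span S"
  using x
proof (induction rule: span_induct_alt)
  case base
  show ?case by (simp add: span_zero)
next
  case (step a s x)
  have "s * y \<in> span S" using y
  proof (induction rule: span_induct_alt)
    case base
    show ?case by (simp add: span_zero)
  next
    case (step b t z)
    then show ?case
      by (simp add: distrib_left scale_mult_right span_add span_scale span_base closed \<open>s \<in> S\<close>)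
  qed
  with step show ?case by (simp add: distrib_right scale_mult_left span_add span_scale)
qed

text \<open>The span is itself a subalgebra containing \<open>V\<close>, hence contains the smallest
  one.\<close>

lemma span_products_eq_UNIV:
  assumes "generates_algebra scale V"
  shows "span (products V) = UNIV"
proof -
  have "subalgebra scale (span (products V))"
    unfolding subalgebra_def by (auto intro: span_mult_closed products_mult)
  then have "subalgebra scale hull V \<subseteq> span (products V)"
    by (intro hull_minimal) (use subset_products span_superset in blast)+
  with assms show ?thesis unfolding generates_algebra_def by blast
qed

text \<open>Lets sums over different supports be taken over one common index set.\<close>

lemma poly_eval_superset:
  assumes "finite A" and "Poly_Mapping.keys p \<subseteq> A"
  shows "poly_eval scale v p = (\<Sum>w\<in>A. scale (Poly_Mapping.lookup p w) (word_eval v w))"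
  unfolding poly_eval_def using assms
  by (intro sum.mono_neutral_left) (auto simp: in_keys_iff)

lemma poly_eval_add: "poly_eval scale v (p + q) = poly_eval scale v p + poly_eval scale v q"
proof -
  let ?A = "Poly_Mapping.keys p \<union> Poly_Mapping.keys q"
  have "Poly_Mapping.keys (p + q) \<subseteq> ?A" by (rule Poly_Mapping.keys_add)
  then show ?thesis
    by (simp add: poly_eval_superset[where A = ?A] lookup_add scale_left_distrib sum.distrib)
qed

lemma poly_eval_sum: "poly_eval scale v (sum f A) = (\<Sum>a\<in>A. poly_eval scale v (f a))"
  by (induction A rule: infinite_finite_induct) (simp_all add: poly_eval_add, simp_all add: poly_eval_def)

lemma poly_eval_single:
  "poly_eval scale v (Poly_Mapping.single w a) = scale a (word_eval v w)"
  by (simp add: poly_eval_superset[where A = "{w}"])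

text \<open>Substitute in each word separately and add up the resulting monomials; a sum of
  \<open>single\<close> terms stays correct even if distinct words become equal.\<close>

lemma ex_poly_subst:
  fixes p :: "('x, 'f) free_algebra" and s :: "'x \<Rightarrow> 'y word"
  obtains q :: "('y, 'f) free_algebra"
  where "\<And>v. poly_eval scale v q = poly_eval scale (\<lambda>x. word_eval v (s x)) p"
proof
  fix v
  show "poly_eval scale v (\<Sum>w\<in>Poly_Mapping.keys p.
      Poly_Mapping.single (subst_word s w) (Poly_Mapping.lookup p w)) =
    poly_eval scale (\<lambda>x. word_eval v (s x)) p"
    by (simp add: poly_eval_sum poly_eval_single word_eval_subst_word) (simp add: poly_eval_def)
qed

lemma subspace_poly_eval_zeros:
  assumes "multilinear n p" and "i \<in> {1..n}"
  shows "subspace {x. poly_eval scale (v(i := x)) p = 0}"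
proof -
  have w: "distinct (letters w)" "i \<in> set (letters w)" if "w \<in> Poly_Mapping.keys p" for w
    using assms that unfolding multilinear_def by auto
  have add: "poly_eval scale (v(i := x + y)) p =
      poly_eval scale (v(i := x)) p + poly_eval scale (v(i := y)) p" for x y
    by (simp add: poly_eval_def w word_eval_upd_add scale_right_distrib sum.distrib)
  have scale: "poly_eval scale (v(i := scale a x)) p = scale a (poly_eval scale (v(i := x)) p)" for a x
    by (simp add: poly_eval_def w word_eval_upd_scale scale_sum_right mult.commute)
  show ?thesis
    \<comment> \<open>The instance \<open>scale[of 0 0]\<close> shows that the zero vector is in the
      set.\<close>
    using scale[of 0 0] by (intro subspaceI) (simp_all add: add scale)
qed

text \<open>The coordinates are moved into \<open>S\<close> one at a time, keeping the value
  nonzero.\<close>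

lemma multilinear_nonzero_on_spanning_set:
  assumes lin: "multilinear n p" and span: "span S = UNIV"
    and nz: "poly_eval scale v p \<noteq> 0"
  obtains u where "\<And>i. i \<in> {1..n} \<Longrightarrow> u i \<in> S" and "poly_eval scale u p \<noteq> 0"
proof -
  have "\<exists>u. (\<forall>i\<in>I. u i \<in> S) \<and> poly_eval scale u p \<noteq> 0" if "finite I" "I \<subseteq> {1..n}" for I
    using that
  proof (induction I rule: finite_induct)
    case empty
    show ?case using nz by blast
  next
    case (insert i I)
    then obtain u where u: "\<forall>j\<in>I. u j \<in> S" "poly_eval scale u p \<noteq> 0" by auto
    have "\<exists>x\<in>S. poly_eval scale (u(i := x)) p \<noteq> 0"
    proof (rule ccontr)
      assume "\<not> ?thesis"
      \<comment> \<open>By linearity in the \<open>i\<close>-th variable, vanishing on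
        \<open>S\<close> would spread to its span, which contains the old value
        \<open>u i\<close>.\<close>
      then have "span S \<subseteq> {x. poly_eval scale (u(i := x)) p = 0}"
        using insert.prems by (intro span_minimal subspace_poly_eval_zeros[OF lin]) auto
      then have "poly_eval scale (u(i := u i)) p = 0" unfolding span by blast
      with u show False by simp
    qed
    then obtain x where "x \<in> S" "poly_eval scale (u(i := x)) p \<noteq> 0" by blast
    moreover have "\<forall>j\<in>insert i I. (u(i := x)) j \<in> S" using u \<open>x \<in> S\<close> by auto
    ultimately show ?case by blast
  qed
  from this[of "{1..n}"] that show thesis by blast
qed

end

theorem lemma2p1:
  fixes scale :: "'f::field \<Rightarrow> 'r::ring \<Rightarrow> 'r"
    and V :: "'r set"
    and c :: "(nat, 'f) free_algebra"
    and n :: nat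
  assumes "assoc_algebra scale"
    and "(center :: 'r set) \<noteq> {0}"
    and "module.subspace scale V"
    and "generates_algebra scale V"
    and "multilinear n c"
    and "central_polynomial scale c"
  shows "\<exists>c' :: (nat \<times> nat, 'f) free_algebra. central_polynomial_pair scale V c'"
proof -
  interpret assoc_algebra scale by fact
  have central: "\<And>v. poly_eval scale v c \<in> center" and "\<exists>v. poly_eval scale v c \<noteq> 0"
    using assms(6)
    unfolding central_polynomial_def central_polynomial_pair_def pair_identity_def by auto
  then obtain m where m: "\<And>i. i \<in> {1..n} \<Longrightarrow> m i \<in> products V" and nz: "poly_eval scale m c \<noteq> 0"
    using multilinear_nonzero_on_spanning_set[OF assms(5) span_products_eq_UNIV[OF assms(4)]]
    by metis
  have "0 \<in> V" using assms(3) by (rule subspace_0)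
  have "\<exists>(u :: nat \<Rightarrow> 'r) w. range u \<subseteq> V \<and> (i \<in> {1..n} \<longrightarrow> m i = word_eval u w)" for i
  proof (cases "i \<in> {1..n}")
    case True
    then show ?thesis using m[OF True] unfolding products_def by blast
  next
    case False
    \<comment> \<open>For indices outside \<open>{1..n}\<close> the zero assignment is a default
      value that stays in \<open>V\<close>.\<close>
    then show ?thesis using \<open>0 \<in> V\<close> by (intro exI[of _ "\<lambda>_. 0"]) auto
  qed
  then obtain u :: "nat \<Rightarrow> nat \<Rightarrow> 'r" and w
    where u: "\<And>i. range (u i) \<subseteq> V" and w: "\<And>i. i \<in> {1..n} \<Longrightarrow> m i = word_eval (u i) (w i)"
    by metis
  \<comment> \<open>Tagging with \<open>Pair i\<close> gives the words for different
    \<open>i\<close> disjoint variables, so the assignments \<open>u i\<close> merge into a single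
    one on pairs.\<close>
  obtain c' :: "(nat \<times> nat, 'f) free_algebra" where c':
    "\<And>v. poly_eval scale v c' = poly_eval scale (\<lambda>i. word_eval v (map_word (Pair i) (w i))) c"
    by (rule ex_poly_subst[of "\<lambda>i. map_word (Pair i) (w i)" c]) blast
  \<comment> \<open>Agreement with \<open>m\<close> is known only on \<open>{1..n}\<close>, but by
    multilinearity all letters of \<open>c\<close> lie there.\<close>
  have "poly_eval scale (\<lambda>(i, j). u i j) c' = poly_eval scale m c"
    unfolding c' using assms(5)
    by (intro poly_eval_cong) (auto simp: word_eval_map_word w multilinear_def)
  moreover have "\<forall>ij. (\<lambda>(i, j). u i j) ij \<in> V" using u by auto
  ultimately have "\<not> pair_identity scale V c'"
    unfolding pair_identity_def using nz by metis
  then have "central_polynomial_pair scale V c'"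
    unfolding central_polynomial_pair_def c' using central by blast
  then show ?thesis by blast
qed

end
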